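(* Let $X$ be a real Banach space. Suppose there are $\phi\in\mathscr{L}(X)$ and a constant $c>0$ such that $\phi\notin\mathrm{span}\{I\}$, $\mathrm{Ker}(\phi)=\{0\}$ and $\|\phi^{-1}y\|\le c\|y\|$ for all $y\in\phi(X)$. Then $X$ is a $\phi$-space.
   Context: $\mathscr{L}(X)$ denotes the bounded linear operators $X\to X$, $I$ is the identity of $X$, and $\mathrm{span}\{I\}$ is the vector space of scalar multiples of $I$; for injective $\phi$, $\phi^{-1}:\phi(X)\to X$ is the inverse of $\phi$ on its range. $\phi$-space: for $\phi\in\mathscr{L}(X)$ with $\phi\notin\mathrm{span}\{I\}$, $X$ is called a $\phi$-space if for every bounded and weakly closed subset $C$ of $X$ such that $\phi(C)$ is relatively compact (in norm), $C$ is weakly compact. *)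

theory Defs
  imports "HOL-Analysis.Analysis"
begin

text \<open>The weak topology: the coarsest topology making every element of the dual continuous.\<close>

definition weak_topology :: "'a::real_normed_vector topology" where
  "weak_topology =
     topology_generated_by {blinfun_apply f -` U | (f :: 'a \<Rightarrow>\<^sub>L real) U. open U}"

lemma topspace_weak_topology [simp]: "topspace weak_topology = UNIV"
proof -
  have "UNIV \<in> {blinfun_apply f -` U | (f :: 'a \<Rightarrow>\<^sub>L real) U. open U}"
    by force
  then show ?thesis
    unfolding weak_topology_def topology_generated_by_topspace by blast
qed

text \<open>
  The space is the whole type \<open>'a\<close>, so it appears only through the type of \<open>\<phi>\<close>.
  The notion is defined only for \<open>\<phi>\<close> outside the span of the identity; this proviso is
  part of the predicate, which is false for scalar multiples of the identity.
  Relative compactness means that the norm closure is norm compact.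
\<close>

definition phi_space :: "('a::banach \<Rightarrow>\<^sub>L 'a) \<Rightarrow> bool" where
  "phi_space \<phi> \<longleftrightarrow>
     \<phi> \<notin> span {id_blinfun} \<and>
     (\<forall>C. bounded C \<and> closedin weak_topology C \<and> compact (closure (blinfun_apply \<phi> ` C))
        \<longrightarrow> compactin weak_topology C)"

end

theory Submission imports Defs begin

text \<open>
  The estimate on \<open>\<phi>\<^sup>-\<^sup>1\<close> says that \<open>\<phi>\<close> is bounded below, that is, an isomorphism onto its range.
  Completeness then makes the range closed, so the compact set \<open>K = closure (\<phi> ` C)\<close> stays inside
  the range, and \<open>\<phi>\<^sup>-\<^sup>1 ` K\<close> is norm compact because \<open>\<phi>\<^sup>-\<^sup>1\<close> is Lipschitz there. This set contains
  \<open>C\<close>, which is norm closed since the weak topology is coarser than the norm topology. Hence \<open>C\<close>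
  is norm compact, and norm compactness implies weak compactness, once more by comparing the
  two topologies.
\<close>

lemma openin_weak_imp_open:
  fixes U :: "'a::real_normed_vector set"
  assumes "openin weak_topology U"
  shows "open U"
proof -
  have "generate_topology_on {blinfun_apply f -` V | (f :: 'a \<Rightarrow>\<^sub>L real) V. open V} U"
    using assms by (simp only: weak_topology_def openin_topology_generated_by_iff)
  then show ?thesis
  proof (rule generate_topology_on_coarsest[rotated 2])
    show "istopology (open :: 'a set \<Rightarrow> bool)"
      by (rule istopology_open)
    fix S :: "'a set"
    assume "S \<in> {blinfun_apply f -` V | (f :: 'a \<Rightarrow>\<^sub>L real) V. open V}"
    then obtain f :: "'a \<Rightarrow>\<^sub>L real" and V where S: "S = blinfun_apply f -` V" and V: "open V"
      by blast
    show "open S"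
      unfolding S by (intro open_vimage V continuous_intros)
  qed
qed

lemma closedin_weak_imp_closed:
  "closedin weak_topology C \<Longrightarrow> closed C"
  unfolding closedin_def closed_def Compl_eq_Diff_UNIV by (simp add: openin_weak_imp_open)

lemma compact_imp_compactin_weak:
  "compact C \<Longrightarrow> compactin weak_topology C"
  by (rule compactin_contractive[of euclidean]) (simp_all add: openin_weak_imp_open)

text \<open>
  Completeness of the domain enters through the closedness of \<open>range f\<close>: it keeps the limit points
  of \<open>f ` C\<close> inside the set where the Lipschitz map \<open>inv f\<close> really inverts \<open>f\<close>, so that compactness
  can be carried back.
\<close>

lemma compact_if_image_relatively_compact:
  fixes f :: "'a::banach \<Rightarrow> 'b::real_normed_vector"
  assumes lin: "bounded_linear f" and c: "c > 0"
    and below: "\<And>x. norm x \<le> c * norm (f x)"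
    and C: "closed C" and K: "compact (closure (f ` C))"
  shows "compact C"
proof -
  interpret bounded_linear f by (fact lin)
  have inj: "inj f"
  proof (rule injI)
    fix x y assume "f x = f y"
    then show "x = y" using below[of "x - y"] by (simp add: diff)
  qed
  have "complete (range f)"
  proof (rule complete_isometric_image[OF _ subspace_UNIV lin])
    show "0 < 1 / c" using c by simp
    show "\<forall>x\<in>UNIV. 1 / c * norm x \<le> norm (f x)"
      using below c by (simp add: field_simps)
  qed (rule complete_UNIV)
  then have sub: "closure (f ` C) \<subseteq> range f"
    by (intro closure_minimal complete_imp_closed) auto
  have "c-lipschitz_on (range f) (inv f)"
  proof (rule lipschitz_onI)
    fix y z assume "y \<in> range f" "z \<in> range f"
    then obtain u v where "y = f u" "z = f v" by auto
    then show "dist (inv f y) (inv f z) \<le> c * dist y z"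
      using below[of "u - v"] inj by (simp add: dist_norm diff)
  qed (use c in simp)
  then have "continuous_on (closure (f ` C)) (inv f)"
    using sub lipschitz_on_continuous_on continuous_on_subset by blast
  then have "compact (inv f ` closure (f ` C))"
    using K compact_continuous_image by blast
  moreover have "C \<subseteq> inv f ` closure (f ` C)"
    using image_mono[OF closure_subset, of "inv f" "f ` C"] inj by simp
  ultimately show ?thesis
    using compact_Int_closed[OF _ C, of "inv f ` closure (f ` C)"] by (simp only: inf.absorb2)
qed

theorem proposition2p1:
  fixes \<phi> :: "'a::banach \<Rightarrow>\<^sub>L 'a" and c :: real
  assumes "\<phi> \<notin> span {id_blinfun}"
    and "{x. blinfun_apply \<phi> x = 0} = {0}"
    and "c > 0"
    and "\<forall>y \<in> range (blinfun_apply \<phi>). norm (inv (blinfun_apply \<phi>) y) \<le> c * norm y"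
  shows "phi_space \<phi>"
proof -
  have inj: "inj (blinfun_apply \<phi>)"
  proof (rule injI)
    fix x y assume "blinfun_apply \<phi> x = blinfun_apply \<phi> y"
    then have "x - y \<in> {x. blinfun_apply \<phi> x = 0}"
      by (simp add: blinfun.diff_right)
    then show "x = y" unfolding assms(2) by simp
  qed
  have below: "norm x \<le> c * norm (blinfun_apply \<phi> x)" for x
    using assms(4) inj by (metis inv_f_f rangeI)
  show ?thesis
    unfolding phi_space_def
  proof (intro conjI allI impI)
    fix C
    assume C: "bounded C \<and> closedin weak_topology C \<and> compact (closure (blinfun_apply \<phi> ` C))"
    have "compact C"
    proof (rule compact_if_image_relatively_compact[OF blinfun.bounded_linear_right \<open>c > 0\<close> below])
      show "closed C" using C by (simp add: closedin_weak_imp_closed)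
      show "compact (closure (blinfun_apply \<phi> ` C))" using C by simp
    qed
    then show "compactin weak_topology C"
      by (rule compact_imp_compactin_weak)
  qed (fact assms(1))
qed

end
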